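(* Let $G$ be a real Lie group, $E$ a countable set with a coding map $E\to G$, $e\mapsto g_e$, and assume given a Markov chain on $E$ that is irreducible and recurrent. Let $e,e'\in E$. (i) Let $c\in E^*$ be $(e'{\leftarrow}e)$-admissible and $c'\in E^*$ be $(e{\leftarrow}e')$-admissible. Then the semigroups $G_e^+$ and $G_{e'}^+$ satisfy $g_{c'}G_{e'}^+g_c\subset G_e^+$. If $G$ is real algebraic, we additionally have the following. (ii) The groups $H_e$ and $H_{e'}$ are conjugate inside $H_{\mathcal{S}}$. More precisely, with $c,c'$ as in (i) we have $g_{c'}H_{e'}g_{c'}^{-1}=g_c^{-1}H_{e'}g_c=H_e$. (iii) If there exists $\tilde e\in E$ with both words $e\tilde e$ and $e'\tilde e$ admissible, then $H_e=H_{e'}$. (iv) If there exists $\tilde e\in E$ with $f\tilde e$ admissible for all $f\in E$, then all $H_f$, $f\in E$, coincide and $H_{\mathcal{S}}$ is contained in their normalizer. (v) If there exists $\tilde e\in E$ with $\tilde ef$ admissible for all $f\in E$, then $H_f=H_{\mathcal{S}}$ for all $f\in E$. In particular, $H_{\mathcal{S}}$ is a group.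
   Context: Markov chain notation: $p_{e',e}$ is the probability of going from state $e$ to state $e'$; $\mathbb{P}_e$ is the Markov measure on $E^{\mathbb{N}}$ (indices from $0$) started at $\omega_0=e$; $\tau_e(\omega)=\inf\{n\ge1:\omega_n=e\}$. Irreducible: $\mathbb{P}_e[\tau_{e'}<\infty]>0$ for all $e,e'$. Recurrent: $\mathbb{P}_e[\tau_e<\infty]=1$ for all $e$. $E^*$ is the set of finite words over $E$, written right to left: for $w=e_{n-1}\ldots e_0$, $g_w=g_{e_{n-1}}\cdots g_{e_0}$. A non-empty word $w=e_{n-1}\ldots e_0$ is $(e'{\leftarrow}e)$-admissible if $e_0=e$, $p_{e_k,e_{k-1}}>0$ for $1\le k\le n-1$, and $p_{e',e_{n-1}}>0$; it is admissible if it is $(e'{\leftarrow}e)$-admissible for some $e,e'\in E$. The renewal measure $\mu_e$ is the law on $G$ of $g_{\omega_{\tau_e-1}}\cdots g_{\omega_0}$ under $\mathbb{P}_e$. $G_e^+$ is the closed subsemigroup of $G$ generated by $\operatorname{supp}(\mu_e)$. $G_{\mathcal{S}}=\{g_w: w\in E^*\text{ admissible}\}$ (in general not closed under multiplication). When $G$ is real algebraic, $H_e$ and $H_{\mathcal{S}}$ are the Zariski closures in $G$ of $G_e^+$ and $G_{\mathcal{S}}$, respectively (each $H_e$ is a group). *)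

theory Defs
  imports "HOL-Probability.Probability" "HOL-Algebra.Group_Action"
begin

section \<open>Lie groups\<close>

text \<open>\<open>k\<close> times continuous differentiability, for maps on an open subset of a finite-dimensional space.\<close>

primrec Ck_on :: "nat \<Rightarrow> 'a::real_normed_vector set \<Rightarrow> ('a \<Rightarrow> 'b::real_normed_vector) \<Rightarrow> bool"
  where
    "Ck_on 0 S f \<longleftrightarrow> continuous_on S f"
  | "Ck_on (Suc k) S f \<longleftrightarrow>
      (\<exists>D. (\<forall>x\<in>S. (f has_derivative D x) (at x)) \<and> (\<forall>v. Ck_on k S (\<lambda>x. D x v)))"

definition smooth_on :: "'a::real_normed_vector set \<Rightarrow> ('a \<Rightarrow> 'b::real_normed_vector) \<Rightarrow> bool"
  where "smooth_on S f \<longleftrightarrow> (\<forall>k. Ck_on k S f)"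

text \<open>
  A smooth atlas for \<open>T\<close> is a set of charts \<open>(U, \<phi>)\<close>. The model space is a
  finite-dimensional \<open>'v::real_normed_vector\<close>; the class \<open>euclidean_space\<close> would exclude dimension
  zero, that is, discrete groups.
\<close>

definition smooth_atlas :: "'g topology \<Rightarrow> ('g set \<times> ('g \<Rightarrow> 'v::real_normed_vector)) set \<Rightarrow> bool"
  where "smooth_atlas T A \<longleftrightarrow>
    (\<exists>B::'v set. finite B \<and> span B = UNIV) \<and>
    (\<Union>(U, \<phi>)\<in>A. U) = topspace T \<and>
    (\<forall>(U, \<phi>)\<in>A. openin T U \<and> open (\<phi> ` U) \<and>
        homeomorphic_map (subtopology T U) (top_of_set (\<phi> ` U)) \<phi>) \<and>
    (\<forall>(U, \<phi>)\<in>A. \<forall>(V, \<psi>)\<in>A. smooth_on (\<phi> ` (U \<inter> V)) (\<lambda>x. \<psi> (inv_into U \<phi> x)))"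

text \<open>
  Second countability is not required, so that Lie groups with uncountably many components are
  included.
\<close>

locale lie_group = group G
  for G :: "('g, 'm) monoid_scheme" (structure) +
  fixes T :: "'g topology"
    and A :: "('g set \<times> ('g \<Rightarrow> 'v::real_normed_vector)) set"
  assumes topspace_eq: "topspace T = carrier G"
    and Hausdorff: "Hausdorff_space T"
    and atlas: "smooth_atlas T A"
    and continuous_mult: "continuous_map (prod_topology T T) T (\<lambda>(x, y). x \<otimes> y)"
    and continuous_inv: "continuous_map T T (\<lambda>x. inv x)"
    and smooth_mult: "\<lbrakk>(U, \<phi>) \<in> A; (V, \<psi>) \<in> A; (W, \<theta>) \<in> A\<rbrakk> \<Longrightarrow>
      smooth_on {(x, y). x \<in> \<phi> ` U \<and> y \<in> \<psi> ` V \<and> inv_into U \<phi> x \<otimes> inv_into V \<psi> y \<in> W}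
        (\<lambda>(x, y). \<theta> (inv_into U \<phi> x \<otimes> inv_into V \<psi> y))"
    and smooth_inv: "\<lbrakk>(U, \<phi>) \<in> A; (W, \<theta>) \<in> A\<rbrakk> \<Longrightarrow>
      smooth_on {x \<in> \<phi> ` U. inv (inv_into U \<phi> x) \<in> W} (\<lambda>x. \<theta> (inv (inv_into U \<phi> x)))"


section \<open>Real algebraic groups and the Zariski topology\<close>

text \<open>
  A real algebraic structure on \<open>G\<close> is an isomorphism \<open>\<rho>\<close> of topological groups from \<open>G\<close> onto a
  Zariski closed subgroup of \<open>GL\<^sub>d(\<real>)\<close>. For Lie groups such a \<open>\<rho>\<close> is automatically smooth.
  On \<open>real^'d^'d\<close>, \<^const>\<open>real_polynomial_function\<close> means: polynomial in the matrix entries.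
  Allowing also \<open>1 / det\<close> would give the same zero sets in \<open>GL\<^sub>d(\<real>)\<close>.
\<close>

definition real_algebraic ::
  "('g, 'm) monoid_scheme \<Rightarrow> 'g topology \<Rightarrow> ('g \<Rightarrow> real^'d^'d) \<Rightarrow> bool"
  where "real_algebraic G T \<rho> \<longleftrightarrow>
    (\<forall>x\<in>carrier G. \<forall>y\<in>carrier G. \<rho> (x \<otimes>\<^bsub>G\<^esub> y) = \<rho> x ** \<rho> y) \<and>
    homeomorphic_map T (top_of_set (\<rho> ` carrier G)) \<rho> \<and>
    (\<exists>F. (\<forall>f\<in>F. real_polynomial_function f) \<and>
         \<rho> ` carrier G = {M. invertible M \<and> (\<forall>f\<in>F. f M = 0)})"

definition zariski_closed ::
  "('g, 'm) monoid_scheme \<Rightarrow> ('g \<Rightarrow> real^'d^'d) \<Rightarrow> 'g set \<Rightarrow> bool"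
  where "zariski_closed G \<rho> Z \<longleftrightarrow>
    (\<exists>F. (\<forall>f\<in>F. real_polynomial_function f) \<and> Z = {x \<in> carrier G. \<forall>f\<in>F. f (\<rho> x) = 0})"

definition zariski_closure ::
  "('g, 'm) monoid_scheme \<Rightarrow> ('g \<Rightarrow> real^'d^'d) \<Rightarrow> 'g set \<Rightarrow> 'g set"
  where "zariski_closure G \<rho> X = zariski_closed G \<rho> hull X"


section \<open>Markov chains\<close>

text \<open>\<open>K e\<close> is the law of the next state after \<open>e\<close>.\<close>

definition trans_prob :: "('e \<Rightarrow> 'e pmf) \<Rightarrow> 'e \<Rightarrow> 'e \<Rightarrow> real"
  where "trans_prob K e' e = pmf (K e) e'"

definition markov_step :: "('e \<Rightarrow> 'e pmf) \<Rightarrow> 'e \<Rightarrow> nat \<Rightarrow> (nat \<Rightarrow> 'e) \<Rightarrow> 'e measure"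
  where "markov_step K e n \<omega> =
    measure_pmf (case n of 0 \<Rightarrow> return_pmf e | Suc m \<Rightarrow> K (\<omega> m))"

interpretation markov: Ionescu_Tulcea "markov_step K e" "\<lambda>_. count_space UNIV"
  for K :: "'e::countable \<Rightarrow> 'e pmf" and e
proof (rule Ionescu_Tulcea.intro)
  fix i
  show "markov_step K e i \<in> Pi\<^sub>M {0..<i} (\<lambda>_. count_space UNIV) \<rightarrow>\<^sub>M subprob_algebra (count_space UNIV)"
  proof (cases i)
    case 0
    then show ?thesis
      by (simp add: markov_step_def[abs_def] space_subprob_algebra
          prob_space_imp_subprob_space measure_pmf.prob_space_axioms)
  next
    case (Suc m)
    have "(\<lambda>\<omega>. \<omega> m) \<in> Pi\<^sub>M {0..<i} (\<lambda>_. count_space (UNIV::'e set)) \<rightarrow>\<^sub>M count_space UNIV"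
      using Suc by (intro measurable_component_singleton) auto
    moreover have "(\<lambda>x. measure_pmf (K x)) \<in> count_space UNIV \<rightarrow>\<^sub>M subprob_algebra (count_space UNIV)"
      by (auto simp: space_subprob_algebra prob_space_imp_subprob_space measure_pmf.prob_space_axioms)
    ultimately show ?thesis
      unfolding markov_step_def[abs_def] using Suc by (simp add: measurable_compose)
  qed
qed (unfold markov_step_def, rule measure_pmf.prob_space_axioms)

definition markov_measure :: "('e::countable \<Rightarrow> 'e pmf) \<Rightarrow> 'e \<Rightarrow> (nat \<Rightarrow> 'e) measure"
  where "markov_measure K e = markov.PF.lim K e"

lemma sets_markov_measure: "sets (markov_measure K e) = sets (Pi\<^sub>M UNIV (\<lambda>_. count_space UNIV))"
  by (simp add: markov_measure_def)

lemma space_markov_measure: "space (markov_measure K e) = UNIV"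
  by (simp add: markov_measure_def space_PiM)

lemma emeasure_markov_C:
  fixes K :: "'e::countable \<Rightarrow> 'e pmf"
  shows "emeasure (markov.C K e 0 n (\<lambda>_. undefined)) (\<Pi>\<^sub>E i\<in>{0..<n}. {w i}) =
    (\<Prod>i<n. emeasure (markov_step K e i w) {w i})"
proof (induction n)
  case 0
  then show ?case
    by (simp add: PiM_empty)
next
  case (Suc n)
  let ?M = "\<lambda>_::nat. count_space (UNIV :: 'e set)"
  let ?C = "markov.C K e 0 n (\<lambda>_. undefined)"
  let ?X = "\<lambda>n. \<Pi>\<^sub>E i\<in>{0..<n}. {w i}"
  have X: "?X m \<in> sets (Pi\<^sub>M {0..<m} ?M)" for m
    by (intro sets_PiM_I_finite) auto
  have undef: "(\<lambda>_. undefined) \<in> space (Pi\<^sub>M {0..<0} ?M)"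
    by (simp add: space_PiM)
  have sets_C: "sets ?C = sets (Pi\<^sub>M {0..<n} ?M)"
    using markov.sets_C[OF undef, of K e n] by simp
  have space_C: "space ?C = space (Pi\<^sub>M {0..<n} ?M)"
    by (rule sets_eq_imp_space_eq[OF sets_C])
  have eP: "markov.eP K e n \<in> ?C \<rightarrow>\<^sub>M subprob_algebra (Pi\<^sub>M {0..<Suc n} ?M)"
    using markov.measurable_eP[of K e n] by (simp cong: measurable_cong_sets add: sets_C)
  have ne: "space ?C \<noteq> {}"
    by (simp add: space_C space_PiM PiE_eq_empty_iff)
  have step: "emeasure (markov.eP K e n \<omega>) (?X (Suc n)) =
      emeasure (markov_step K e n w) {w n} * indicator (?X n) \<omega>" if \<omega>: "\<omega> \<in> space ?C" for \<omega>
  proof -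
    have \<omega>': "\<omega> \<in> space (Pi\<^sub>M {0..<n} ?M)"
      using \<omega> by (simp add: space_C)
    have ext: "\<omega> \<in> extensional {0..<n}"
      using \<omega>' by (auto simp: space_PiM PiE_iff)
    have vimage: "(\<lambda>x. fun_upd \<omega> n x) -` ?X (Suc n) = (if \<omega> \<in> ?X n then {w n} else {})"
    proof -
      have "fun_upd \<omega> n x \<in> ?X (Suc n) \<longleftrightarrow> \<omega> \<in> ?X n \<and> x = w n" for x
        using ext by (force simp: PiE_iff extensional_def less_Suc_eq)
      then show ?thesis by auto
    qed
    have "\<omega> \<in> ?X n \<Longrightarrow> markov_step K e n \<omega> = markov_step K e n w"
      by (cases n) (auto simp: markov_step_def PiE_iff)
    then show ?thesis
      using markov.emeasure_eP[OF \<omega>' X, of K e] vimage by (auto simp: indicator_def)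
  qed
  have "emeasure (markov.C K e 0 (Suc n) (\<lambda>_. undefined)) (?X (Suc n)) =
      (\<integral>\<^sup>+\<omega>. emeasure (markov.eP K e n \<omega>) (?X (Suc n)) \<partial>?C)"
    using emeasure_bind[OF ne eP X] by simp
  also have "\<dots> = (\<integral>\<^sup>+\<omega>. emeasure (markov_step K e n w) {w n} * indicator (?X n) \<omega> \<partial>?C)"
    by (intro nn_integral_cong step)
  also have "\<dots> = emeasure (markov_step K e n w) {w n} * emeasure ?C (?X n)"
    using X[of n] by (intro nn_integral_cmult_indicator) (simp add: sets_C)
  finally show ?case
    using Suc by (simp add: mult.commute)
qed

lemma emeasure_markov_measure_cylinder:
  fixes K :: "'e::countable \<Rightarrow> 'e pmf"
  shows "emeasure (markov_measure K e) {\<omega>. \<forall>i\<le>n. \<omega> i = w i} =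
    (if w 0 = e then \<Prod>i<n. trans_prob K (w (Suc i)) (w i) else 0)"
proof -
  let ?M = "\<lambda>_::nat. count_space (UNIV :: 'e set)"
  let ?J = "{0..<Suc n}"
  let ?X = "\<Pi>\<^sub>E i\<in>?J. {w i}"
  have X: "?X \<in> sets (Pi\<^sub>M ?J ?M)"
    by (intro sets_PiM_I_finite) auto
  have "{\<omega>. \<forall>i\<le>n. \<omega> i = w i} = prod_emb UNIV ?M ?J ?X"
    by (force simp: prod_emb_def restrict_PiE_iff space_PiM less_Suc_eq_le Pi_iff)
  then have "emeasure (markov_measure K e) {\<omega>. \<forall>i\<le>n. \<omega> i = w i} =
      emeasure (markov.CI K e ?J) ?X"
    using markov.lim[OF _ X, of K e] by (simp add: markov_measure_def)
  also have "\<dots> = emeasure (markov.C K e 0 (Suc n) (\<lambda>_. undefined)) ?X"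
    using markov.emeasure_CI[OF order_refl X, of K e] X
    by (simp add: prod_emb_id sets.sets_into_space[OF X, unfolded space_PiM])
  also have "\<dots> = (\<Prod>i<Suc n. emeasure (markov_step K e i w) {w i})"
    by (rule emeasure_markov_C)
  also have "\<dots> = emeasure (return_pmf e) {w 0} * (\<Prod>i<n. emeasure (K (w i)) {w (Suc i)})"
    by (simp only: prod.lessThan_Suc_shift markov_step_def nat.case)
  also have "(\<Prod>i<n. emeasure (K (w i)) {w (Suc i)}) =
      ennreal (\<Prod>i<n. trans_prob K (w (Suc i)) (w i))"
    by (simp add: trans_prob_def emeasure_pmf_single prod_ennreal)
  finally show ?thesis
    by (auto simp: emeasure_pmf_single)
qed

definition hitting_time :: "'e \<Rightarrow> (nat \<Rightarrow> 'e) \<Rightarrow> enat"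
  where "hitting_time e \<omega> = (INF n\<in>{n. n \<ge> 1 \<and> \<omega> n = e}. enat n)"

definition irreducible_chain :: "('e::countable \<Rightarrow> 'e pmf) \<Rightarrow> bool"
  where "irreducible_chain K \<longleftrightarrow>
    (\<forall>e e'. emeasure (markov_measure K e) {\<omega>. hitting_time e' \<omega> < \<infinity>} > 0)"

definition recurrent_chain :: "('e::countable \<Rightarrow> 'e pmf) \<Rightarrow> bool"
  where "recurrent_chain K \<longleftrightarrow>
    (\<forall>e. emeasure (markov_measure K e) {\<omega>. hitting_time e \<omega> < \<infinity>} = 1)"


section \<open>Words, renewal measures and the associated semigroups\<close>

text \<open>
  The word \<open>e\<^sub>n\<^sub>-\<^sub>1 \<dots> e\<^sub>0\<close> is the list \<open>[e\<^sub>n\<^sub>-\<^sub>1, \<dots>, e\<^sub>0]\<close>: its starting state is the last element of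
  the list.
\<close>

primrec word_prod :: "('g, 'm) monoid_scheme \<Rightarrow> ('e \<Rightarrow> 'g) \<Rightarrow> 'e list \<Rightarrow> 'g"
  where
    "word_prod G g [] = \<one>\<^bsub>G\<^esub>"
  | "word_prod G g (a # w) = g a \<otimes>\<^bsub>G\<^esub> word_prod G g w"

text \<open>\<open>admissible_between K e' e w\<close>: the word \<open>w\<close> is \<open>(e' \<leftarrow> e)\<close>-admissible.\<close>

definition admissible_between :: "('e \<Rightarrow> 'e pmf) \<Rightarrow> 'e \<Rightarrow> 'e \<Rightarrow> 'e list \<Rightarrow> bool"
  where "admissible_between K e' e w \<longleftrightarrow>
    w \<noteq> [] \<and> last w = e \<and>
    (\<forall>i. Suc i < length w \<longrightarrow> trans_prob K (w ! i) (w ! Suc i) > 0) \<and>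
    trans_prob K e' (hd w) > 0"

definition admissible :: "('e \<Rightarrow> 'e pmf) \<Rightarrow> 'e list \<Rightarrow> bool"
  where "admissible K w \<longleftrightarrow> (\<exists>e' e. admissible_between K e' e w)"

definition renewal_word :: "'e \<Rightarrow> (nat \<Rightarrow> 'e) \<Rightarrow> 'e list"
  where "renewal_word e \<omega> = map \<omega> (rev [0..<the_enat (hitting_time e \<omega>)])"

definition borel_of_topology :: "'g topology \<Rightarrow> 'g measure"
  where "borel_of_topology T = sigma (topspace T) {U. openin T U}"

text \<open>The value \<open>\<one>\<close> on paths that do not return to \<open>e\<close> is a dummy; these form a null set for recurrent chains.\<close>

definition renewal_measure ::
  "('g, 'm) monoid_scheme \<Rightarrow> 'g topology \<Rightarrow> ('e::countable \<Rightarrow> 'g) \<Rightarrow> ('e \<Rightarrow> 'e pmf) \<Rightarrow> 'e \<Rightarrow> 'g measure"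
  where "renewal_measure G T g K e =
    distr (markov_measure K e) (borel_of_topology T)
      (\<lambda>\<omega>. if hitting_time e \<omega> < \<infinity> then word_prod G g (renewal_word e \<omega>) else \<one>\<^bsub>G\<^esub>)"

definition support :: "'g topology \<Rightarrow> 'g measure \<Rightarrow> 'g set"
  where "support T \<mu> = {x \<in> topspace T. \<forall>U. openin T U \<and> x \<in> U \<longrightarrow> emeasure \<mu> U > 0}"

definition closed_subsemigroup :: "('g, 'm) monoid_scheme \<Rightarrow> 'g topology \<Rightarrow> 'g set \<Rightarrow> bool"
  where "closed_subsemigroup G T S \<longleftrightarrow>
    S \<subseteq> carrier G \<and> closedin T S \<and> (\<forall>x\<in>S. \<forall>y\<in>S. x \<otimes>\<^bsub>G\<^esub> y \<in> S)"

definition renewal_semigroup ::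
  "('g, 'm) monoid_scheme \<Rightarrow> 'g topology \<Rightarrow> ('e::countable \<Rightarrow> 'g) \<Rightarrow> ('e \<Rightarrow> 'e pmf) \<Rightarrow> 'e \<Rightarrow> 'g set"
  where "renewal_semigroup G T g K e =
    closed_subsemigroup G T hull support T (renewal_measure G T g K e)"

definition admissible_products ::
  "('g, 'm) monoid_scheme \<Rightarrow> ('e \<Rightarrow> 'g) \<Rightarrow> ('e \<Rightarrow> 'e pmf) \<Rightarrow> 'g set"
  where "admissible_products G g K = {word_prod G g w |w. admissible K w}"

definition renewal_zariski ::
  "('g, 'm) monoid_scheme \<Rightarrow> 'g topology \<Rightarrow> ('g \<Rightarrow> real^'d^'d) \<Rightarrow> ('e::countable \<Rightarrow> 'g) \<Rightarrow>
    ('e \<Rightarrow> 'e pmf) \<Rightarrow> 'e \<Rightarrow> 'g set"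
  where "renewal_zariski G T \<rho> g K e = zariski_closure G \<rho> (renewal_semigroup G T g K e)"

definition admissible_zariski ::
  "('g, 'm) monoid_scheme \<Rightarrow> ('g \<Rightarrow> real^'d^'d) \<Rightarrow> ('e \<Rightarrow> 'g) \<Rightarrow> ('e \<Rightarrow> 'e pmf) \<Rightarrow> 'g set"
  where "admissible_zariski G \<rho> g K = zariski_closure G \<rho> (admissible_products G g K)"

end

theory Submission
  imports Defs "HOL-Library.Function_Algebras"
begin

text \<open>
  Almost every path of the chain spells admissible words, and every loop at \<open>e\<close> factors into first
  returns, each of which has positive probability. Hence \<open>G\<^sub>e\<^sup>+\<close> is the closure of the semigroup \<open>L\<^sub>e\<close>
  of the products along loops at \<open>e\<close>, and \<open>H\<^sub>e\<close> is the Zariski closure of \<open>L\<^sub>e\<close>. Concatenation of words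
  gives \<open>g\<^sub>c\<^sub>' L\<^sub>e\<^sub>' g\<^sub>c \<subseteq> L\<^sub>e\<close>, which passes to closures because translations are continuous in both topologies;
  since \<open>g\<^sub>c\<^sub>' g\<^sub>c \<in> L\<^sub>e\<close> and \<open>H\<^sub>e\<close> is a group, the conjugacy statements follow. If \<open>d\<close> is a
  predecessor of both \<open>e\<close> and \<open>e'\<close>, a word from \<open>e'\<close> ending with \<open>d\<close> is both a loop at \<open>e'\<close> and a
  connection to \<open>e\<close>. If \<open>d\<close> is a universal predecessor or successor, every admissible word
  can be completed to a loop at \<open>d\<close> by words with products in \<open>H\<^sub>d\<close>, so \<open>H\<^sub>d\<close> contains all admissible products.
\<close>

section \<open>Polynomials under translation\<close>

interpretation fun_space: vector_space "\<lambda>(c::real) (f::'a \<Rightarrow> real) x. c * f x"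
  by unfold_locales (auto simp: fun_eq_iff algebra_simps)

lemma span_mult_fun:
  fixes f h :: "'a \<Rightarrow> real"
  assumes f: "f \<in> fun_space.span A" and h: "h \<in> fun_space.span B"
  shows "(\<lambda>x. f x * h x) \<in> fun_space.span ((\<lambda>(a, b) x. a x * b x) ` (A \<times> B))" (is "_ \<in> fun_space.span ?C")
proof -
  have lin: "Vector_Spaces.linear (\<lambda>c f x. c * f x) (\<lambda>c f x. c * f x) (\<lambda>f x. k x * f x)"
    for k :: "'a \<Rightarrow> real"
    by unfold_locales (auto simp: fun_eq_iff distrib_left)
  have image: "(\<lambda>f x. k x * f x) ` fun_space.span S = fun_space.span ((\<lambda>f x. k x * f x) ` S)"
    for k :: "'a \<Rightarrow> real" and S
    using module_hom.span_image[OF lin[unfolded linear_iff_module_hom], of k S] ..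
  have swap: "(\<lambda>x. k x * l x) = (\<lambda>x. l x * k x)" for k l :: "'a \<Rightarrow> real"
    by (simp add: mult.commute)
  have "(\<lambda>x. h x * a x) \<in> fun_space.span ?C" if "a \<in> A" for a
  proof -
    have "(\<lambda>x. a x * h x) \<in> fun_space.span ((\<lambda>f x. a x * f x) ` B)"
      using h by (subst image[symmetric]) blast
    moreover have "(\<lambda>f x. a x * f x) ` B \<subseteq> ?C"
      using that by (auto simp: image_iff)
    ultimately show ?thesis
      unfolding swap[of h a] using fun_space.span_mono by blast
  qed
  then have "fun_space.span ((\<lambda>f x. h x * f x) ` A) \<subseteq> fun_space.span ?C"
    by (intro fun_space.span_minimal) auto
  moreover have "(\<lambda>x. h x * f x) \<in> fun_space.span ((\<lambda>f x. h x * f x) ` A)"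
    using f by (subst image[symmetric]) blast
  ultimately show ?thesis
    unfolding swap[of h f] by blast
qed

lemma sum_fun_apply: "(\<Sum>i\<in>I. f i) x = (\<Sum>i\<in>I. f i x)"
  by (induction I rule: infinite_finite_induct) auto

lemma bounded_linear_matrix_mult: "bounded_linear (\<lambda>X. A ** X ** B)"
  for A B :: "real^'d^'d"
  unfolding linear_conv_bounded_linear[symmetric]
proof (rule linearI)
  have "(X + Y) ** B = X ** B + Y ** B" for X Y :: "real^'d^'d"
    by (simp add: vec_eq_iff matrix_matrix_mult_def distrib_right sum.distrib)
  then show "A ** (X + Y) ** B = A ** X ** B + A ** Y ** B" for X Y
    by (simp only: matrix_add_ldistrib)
  show "A ** (k *\<^sub>R X) ** B = k *\<^sub>R (A ** X ** B)" for k X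
    by (simp only: matrix_scalar_ac scalar_matrix_assoc)
qed

lemma real_polynomial_function_finite_translates:
  fixes f :: "real^'d^'d \<Rightarrow> real"
  assumes "real_polynomial_function f"
  shows "\<exists>B. finite B \<and> f \<in> fun_space.span B \<and>
    (\<forall>b\<in>B. \<forall>M. (\<lambda>X. b (M ** X)) \<in> fun_space.span B)"
  using assms
proof induction
  case (linear f)
  let ?B = "(\<lambda>b (X::real^'d^'d). X \<bullet> b) ` Basis"
  have span: "h \<in> fun_space.span ?B" if "bounded_linear h" for h
  proof -
    interpret h: bounded_linear h by fact
    have "h X = (\<Sum>b\<in>Basis. h b * (X \<bullet> b))" for X
      by (subst euclidean_representation[of X, symmetric], unfold h.sum h.scaleR) (simp add: mult.commute)
    then have "h = (\<Sum>b\<in>Basis. (\<lambda>X. h b * (X \<bullet> b)))"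
      unfolding fun_eq_iff sum_fun_apply by blast
    also have "\<dots> \<in> fun_space.span ?B"
      by (intro fun_space.span_sum fun_space.span_scale fun_space.span_base) auto
    finally show ?thesis .
  qed
  have "bounded_linear (\<lambda>X. (M ** X) \<bullet> b)" for M b :: "real^'d^'d"
    using bounded_linear_compose[OF bounded_linear_inner_left bounded_linear_matrix_mult[of M "mat 1"], of b]
    by simp
  with linear show ?case
    by (intro exI[of _ ?B] conjI ballI allI span) auto
next
  case (const c)
  have "(\<lambda>x. c * 1) \<in> fun_space.span {\<lambda>x. 1}"
    by (intro fun_space.span_scale fun_space.span_base) simp
  then show ?case
    by (intro exI[of _ "{\<lambda>x. 1}"] conjI ballI allI) (simp_all add: fun_space.span_base)
next
  case (add f h)
  obtain A where A: "finite A" "f \<in> fun_space.span A"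
      "\<And>b M. b \<in> A \<Longrightarrow> (\<lambda>X. b (M ** X)) \<in> fun_space.span A"
    using add.IH(1) by blast
  obtain B where B: "finite B" "h \<in> fun_space.span B"
      "\<And>b M. b \<in> B \<Longrightarrow> (\<lambda>X. b (M ** X)) \<in> fun_space.span B"
    using add.IH(2) by blast
  have sub: "fun_space.span A \<subseteq> fun_space.span (A \<union> B)" "fun_space.span B \<subseteq> fun_space.span (A \<union> B)"
    by (auto intro!: fun_space.span_mono)
  have "f + h \<in> fun_space.span (A \<union> B)"
    using A(2) B(2) sub by (intro fun_space.span_add) auto
  then have "(\<lambda>x. f x + h x) \<in> fun_space.span (A \<union> B)"
    by (simp add: plus_fun_def)
  moreover have "(\<lambda>X. b (M ** X)) \<in> fun_space.span (A \<union> B)" if "b \<in> A \<union> B" for b M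
    using that A(3) B(3) sub by blast
  ultimately show ?case
    using A(1) B(1) by (intro exI[of _ "A \<union> B"]) simp
next
  case (mult f h)
  obtain A where A: "finite A" "f \<in> fun_space.span A"
      "\<And>b M. b \<in> A \<Longrightarrow> (\<lambda>X. b (M ** X)) \<in> fun_space.span A"
    using mult.IH(1) by blast
  obtain B where B: "finite B" "h \<in> fun_space.span B"
      "\<And>b M. b \<in> B \<Longrightarrow> (\<lambda>X. b (M ** X)) \<in> fun_space.span B"
    using mult.IH(2) by blast
  let ?C = "(\<lambda>(a, b) x. a x * b x) ` (A \<times> B)"
  have "(\<lambda>X. c (M ** X)) \<in> fun_space.span ?C" if "c \<in> ?C" for c M
  proof -
    from that obtain a b where "a \<in> A" "b \<in> B" "c = (\<lambda>x. a x * b x)" by auto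
    then show ?thesis
      using span_mult_fun[OF A(3)[of a M] B(3)[of b M]] by simp
  qed
  moreover have "finite ?C"
    using A(1) B(1) by simp
  ultimately show ?case
    using span_mult_fun[OF A(2) B(2)] by (intro exI[of _ ?C] conjI ballI allI)
qed

lemma (in vector_space) injective_endomorphism_onto:
  assumes lin: "Vector_Spaces.linear scale scale f" and W: "subspace W" and fin: "finite B" "W \<subseteq> span B"
    and inj: "inj_on f W" and into: "f ` W \<subseteq> W"
  shows "f ` W = W"
proof (rule equalityI[OF into])
  interpret f: Vector_Spaces.linear scale scale f by (rule lin)
  obtain C where C: "C \<subseteq> W" "independent C" "W \<subseteq> span C"
    using maximal_independent_subset by blast
  have span_C: "span C = W"
    using C(1,3) W by (rule span_subspace)
  have finC: "finite C"
    using independent_span_bound[OF fin(1) C(2)] subset_trans[OF C(1) fin(2)] by simp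
  have ind: "independent (f ` C)"
    using C(2) inj unfolding span_C[symmetric] by (rule f.independent_injective_image)
  have card: "card (f ` C) = card C"
    using inj C(1) by (intro card_image) (rule inj_on_subset)
  have "c \<in> span (f ` C)" if c: "c \<in> C" for c
  proof (rule ccontr)
    assume nin: "c \<notin> span (f ` C)"
    then have "independent (insert c (f ` C))"
      using ind by (intro independent_insertI)
    moreover have "insert c (f ` C) \<subseteq> span C"
      unfolding span_C using c C(1) into by blast
    ultimately have "card (insert c (f ` C)) \<le> card C"
      using independent_span_bound[OF finC] by simp
    moreover have "c \<notin> f ` C"
      using nin span_base[of c "f ` C"] by metis
    ultimately show False
      using card finC by simp
  qed
  then have "span C \<subseteq> span (f ` C)"
    by (intro span_minimal) auto
  then show "W \<subseteq> f ` W"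
    unfolding f.span_image span_C .
qed

text \<open>The polynomials vanishing on \<open>S\<close> and lying in a given finite-dimensional translation invariant
  space are permuted by translation by \<open>M\<close>, which avoids an appeal to Hilbert's basis theorem.\<close>

lemma real_polynomial_function_vanishes_backwards:
  fixes f :: "real^'d^'d \<Rightarrow> real"
  assumes f: "real_polynomial_function f" and M: "invertible M"
    and S: "\<And>X. X \<in> S \<Longrightarrow> M ** X \<in> S" and f0: "\<And>X. X \<in> S \<Longrightarrow> f X = 0"
    and Y: "M ** Y \<in> S"
  shows "f Y = 0"
proof -
  obtain B where B: "finite B" "f \<in> fun_space.span B"
      "\<And>b M. b \<in> B \<Longrightarrow> (\<lambda>X. b (M ** X)) \<in> fun_space.span B"
    using real_polynomial_function_finite_translates[OF f] by blast
  let ?T = "\<lambda>(h::real^'d^'d \<Rightarrow> real) X. h (M ** X)"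
  define W where "W = {h \<in> fun_space.span B. \<forall>X\<in>S. h X = 0}"
  have lin: "Vector_Spaces.linear (\<lambda>c f x. c * f x) (\<lambda>c f x. c * f x) ?T"
    by unfold_locales (auto simp: fun_eq_iff)
  interpret T: Vector_Spaces.linear "\<lambda>c f x. c * f x" "\<lambda>c f x. c * f x" ?T
    by (rule lin)
  have "?T ` fun_space.span B \<subseteq> fun_space.span B"
    unfolding T.span_image[symmetric] using B(3) by (intro fun_space.span_minimal) auto
  then have into: "?T ` W \<subseteq> W"
    using S by (auto simp: W_def)
  have W: "fun_space.subspace W"
    unfolding W_def by (rule fun_space.subspaceI)
      (simp_all add: fun_space.span_zero fun_space.span_add fun_space.span_scale)
  obtain N where N: "M ** N = mat 1"
    using M by (auto simp: invertible_def)
  have "h = h'" if "?T h = ?T h'" for h h'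
  proof
    fix X
    from fun_cong[OF that, of "N ** X"] show "h X = h' X"
      by (simp add: matrix_mul_assoc N)
  qed
  then have "inj_on ?T W"
    by (intro inj_onI)
  moreover have "W \<subseteq> fun_space.span B"
    unfolding W_def by blast
  ultimately have "?T ` W = W"
    using fun_space.injective_endomorphism_onto[OF lin W B(1) _ _ into] by blast
  moreover have "f \<in> W"
    using B(2) f0 by (simp add: W_def)
  ultimately obtain h where "h \<in> W" "f = ?T h"
    by blast
  then show ?thesis
    using Y by (simp add: W_def)
qed


section \<open>Closures in groups\<close>

locale translation_stable = group G for G (structure) +
  fixes closed :: "'a set \<Rightarrow> bool"
  assumes closed_subset: "closed Z \<Longrightarrow> Z \<subseteq> carrier G"
    and closed_carrier: "closed (carrier G)"
    and closed_Inter: "\<lbrakk>F \<noteq> {}; \<And>Z. Z \<in> F \<Longrightarrow> closed Z\<rbrakk> \<Longrightarrow> closed (\<Inter>F)"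
    and closed_preimage: "\<lbrakk>closed Z; a \<in> carrier G; b \<in> carrier G\<rbrakk> \<Longrightarrow>
      closed {x \<in> carrier G. a \<otimes> x \<otimes> b \<in> Z}"
begin

lemma closed_hull: "X \<subseteq> carrier G \<Longrightarrow> closed (closed hull X)"
  unfolding hull_def using closed_carrier by (intro closed_Inter) auto

lemma hull_subset_carrier: "X \<subseteq> carrier G \<Longrightarrow> closed hull X \<subseteq> carrier G"
  using closed_carrier by (intro hull_minimal)

lemma hull_translate:
  assumes X: "X \<subseteq> carrier G" and Z: "closed Z" and ab: "a \<in> carrier G" "b \<in> carrier G"
    and XZ: "\<And>x. x \<in> X \<Longrightarrow> a \<otimes> x \<otimes> b \<in> Z" and y: "y \<in> closed hull X"
  shows "a \<otimes> y \<otimes> b \<in> Z"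
proof -
  have "closed hull X \<subseteq> {x \<in> carrier G. a \<otimes> x \<otimes> b \<in> Z}"
    using X XZ closed_preimage[OF Z ab] by (intro hull_minimal) auto
  then show ?thesis
    using y by blast
qed

lemma hull_mult_closed:
  assumes X: "X \<subseteq> carrier G" and mult: "\<And>x y. x \<in> X \<Longrightarrow> y \<in> X \<Longrightarrow> x \<otimes> y \<in> X"
    and y: "y \<in> closed hull X" and z: "z \<in> closed hull X"
  shows "y \<otimes> z \<in> closed hull X"
proof -
  have carr: "closed hull X \<subseteq> carrier G"
    using X by (rule hull_subset_carrier)
  have "x \<otimes> z \<in> closed hull X" if x: "x \<in> X" for x
  proof -
    have "x \<otimes> z \<otimes> \<one> \<in> closed hull X"
    proof (rule hull_translate[OF X closed_hull[OF X] _ _ _ z])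
      show "x \<otimes> y \<otimes> \<one> \<in> closed hull X" if "y \<in> X" for y
        using mult[OF x that] x that X by (simp add: subset_eq hull_inc)
    qed (use x X in auto)
    then show ?thesis
      using x z X carr by (simp add: subset_eq)
  qed
  then have "\<one> \<otimes> x \<otimes> z \<in> closed hull X" if "x \<in> X" for x
    using that X by (simp add: subset_eq)
  moreover have "z \<in> carrier G"
    using z carr by blast
  ultimately have "\<one> \<otimes> y \<otimes> z \<in> closed hull X"
    using hull_translate[OF X closed_hull[OF X] one_closed _ _ y] by simp
  then show ?thesis
    using y carr by (simp add: subset_eq)
qed

end

lemma (in lie_group) translation_stable_closedin: "translation_stable G (closedin T)"
proof
  show "closedin T (carrier G)"
    using topspace_eq closedin_topspace[of T] by simp
  fix Z a b
  show "Z \<subseteq> carrier G" if "closedin T Z"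
    using closedin_subset[OF that] topspace_eq by simp
  show "closedin T {x \<in> carrier G. a \<otimes> x \<otimes> b \<in> Z}"
    if Z: "closedin T Z" and ab: "a \<in> carrier G" "b \<in> carrier G"
  proof -
    have "continuous_map T T (\<lambda>x. a \<otimes> x)"
      using continuous_map_compose[OF _ continuous_mult, of T "\<lambda>x. (a, x)"] ab
      by (simp add: o_def continuous_map_pairedI topspace_eq)
    moreover have "continuous_map T T (\<lambda>x. x \<otimes> b)"
      using continuous_map_compose[OF _ continuous_mult, of T "\<lambda>x. (x, b)"] ab
      by (simp add: o_def continuous_map_pairedI topspace_eq)
    ultimately have "continuous_map T T (\<lambda>x. a \<otimes> x \<otimes> b)"
      using continuous_map_compose[of T T "\<lambda>x. a \<otimes> x" T "\<lambda>x. x \<otimes> b"] by (simp add: o_def)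
    from closedin_continuous_map_preimage[OF this Z] show ?thesis
      by (simp add: topspace_eq)
  qed
qed (auto intro: closedin_Inter)


section \<open>Zariski closures\<close>

locale real_algebraic_group = group G for G (structure) +
  fixes T :: "'a topology" and \<rho> :: "'a \<Rightarrow> real^'d^'d"
  assumes topspace_carrier: "topspace T = carrier G"
    and real_algebraic: "real_algebraic G T \<rho>"
begin

lemma rho_mult: "x \<in> carrier G \<Longrightarrow> y \<in> carrier G \<Longrightarrow> \<rho> (x \<otimes> y) = \<rho> x ** \<rho> y"
  using real_algebraic by (simp add: real_algebraic_def)

lemma invertible_rho: "x \<in> carrier G \<Longrightarrow> invertible (\<rho> x)"
  using real_algebraic by (auto simp: real_algebraic_def)

lemma zariski_closed_carrier: "zariski_closed G \<rho> (carrier G)"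
  unfolding zariski_closed_def by (intro exI[of _ "{}"]) simp

lemma zariski_closed_Inter:
  assumes "F \<noteq> {}" "\<And>Z. Z \<in> F \<Longrightarrow> zariski_closed G \<rho> Z"
  shows "zariski_closed G \<rho> (\<Inter>F)"
proof -
  from assms(2) have "\<forall>Z\<in>F. \<exists>P. (\<forall>f\<in>P. real_polynomial_function f) \<and> Z = {x \<in> carrier G. \<forall>f\<in>P. f (\<rho> x) = 0}"
    unfolding zariski_closed_def by blast
  from bchoice[OF this] obtain P where
    P: "\<forall>Z\<in>F. (\<forall>f\<in>P Z. real_polynomial_function f) \<and> Z = {x \<in> carrier G. \<forall>f\<in>P Z. f (\<rho> x) = 0}"
    by (elim exE)
  have mem: "x \<in> Z \<longleftrightarrow> x \<in> carrier G \<and> (\<forall>f\<in>P Z. f (\<rho> x) = 0)" if "Z \<in> F" for x Z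
    using arg_cong[OF bspec[OF P that, THEN conjunct2], of "\<lambda>S. x \<in> S"]
    by (simp only: mem_Collect_eq)
  have "\<Inter>F = {x \<in> carrier G. \<forall>f\<in>\<Union>(P ` F). f (\<rho> x) = 0}"
    using assms(1) by (auto simp: mem)
  moreover have "\<forall>f\<in>\<Union>(P ` F). real_polynomial_function f"
    using P by blast
  ultimately show ?thesis
    unfolding zariski_closed_def by (intro exI[of _ "\<Union>(P ` F)"] conjI)
qed

lemma zariski_closed_preimage:
  assumes "zariski_closed G \<rho> Z" and ab: "a \<in> carrier G" "b \<in> carrier G"
  shows "zariski_closed G \<rho> {x \<in> carrier G. a \<otimes> x \<otimes> b \<in> Z}"
proof -
  obtain F where F: "\<And>f. f \<in> F \<Longrightarrow> real_polynomial_function f"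
    and Z: "Z = {x \<in> carrier G. \<forall>f\<in>F. f (\<rho> x) = 0}"
    using assms(1) unfolding zariski_closed_def by blast
  let ?m = "\<lambda>X. \<rho> a ** X ** \<rho> b"
  have "real_polynomial_function (f \<circ> ?m)" if "f \<in> F" for f
    using polynomial_function_bounded_linear[OF bounded_linear_matrix_mult] F[OF that]
    by (rule real_polynomial_function_compose)
  then have "\<forall>f\<in>(\<lambda>f. f \<circ> ?m) ` F. real_polynomial_function f"
    by blast
  moreover have "{x \<in> carrier G. a \<otimes> x \<otimes> b \<in> Z} = {x \<in> carrier G. \<forall>f\<in>(\<lambda>f. f \<circ> ?m) ` F. f (\<rho> x) = 0}"
    unfolding Z using ab by (auto simp: rho_mult)
  ultimately show ?thesis
    unfolding zariski_closed_def by (intro exI[of _ "(\<lambda>f. f \<circ> ?m) ` F"] conjI)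
qed

sublocale zariski: translation_stable G "zariski_closed G \<rho>"
proof
  show "Z \<subseteq> carrier G" if "zariski_closed G \<rho> Z" for Z
    using that by (auto simp: zariski_closed_def)
qed (fact zariski_closed_carrier zariski_closed_Inter zariski_closed_preimage)+

lemma zariski_closed_imp_closedin:
  assumes "zariski_closed G \<rho> Z"
  shows "closedin T Z"
proof -
  obtain F where F: "\<And>f. f \<in> F \<Longrightarrow> real_polynomial_function f"
    and Z: "Z = {x \<in> carrier G. \<forall>f\<in>F. f (\<rho> x) = 0}"
    using assms unfolding zariski_closed_def by blast
  have hom: "homeomorphic_map T (top_of_set (\<rho> ` carrier G)) \<rho>"
    using real_algebraic by (simp add: real_algebraic_def)
  then have cont: "continuous_map T euclidean \<rho>"
    using homeomorphic_imp_continuous_map continuous_map_in_subtopology by blast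
  have "closed (\<Inter>f\<in>F. {M. f M = 0})"
    using F by (intro closed_INT ballI closed_Collect_eq continuous_on_polymonial_function
        continuous_on_const) (simp add: real_polynomial_function_eq)
  then have "closedin T {x \<in> topspace T. \<rho> x \<in> (\<Inter>f\<in>F. {M. f M = 0})}"
    using cont by (intro closedin_continuous_map_preimage) auto
  moreover have "{x \<in> topspace T. \<rho> x \<in> (\<Inter>f\<in>F. {M. f M = 0})} = Z"
    unfolding Z topspace_carrier by auto
  ultimately show ?thesis
    by simp
qed

lemma subgroup_zariski_closure:
  assumes X: "X \<subseteq> carrier G" "X \<noteq> {}" and mult: "\<And>x y. x \<in> X \<Longrightarrow> y \<in> X \<Longrightarrow> x \<otimes> y \<in> X"
  shows "subgroup (zariski_closure G \<rho> X) G"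
proof -
  let ?Z = "zariski_closure G \<rho> X"
  have Z: "?Z \<subseteq> carrier G"
    using zariski.hull_subset_carrier[OF X(1)] by (simp add: zariski_closure_def)
  have mult_Z: "x \<otimes> y \<in> ?Z" if "x \<in> ?Z" "y \<in> ?Z" for x y
    using that zariski.hull_mult_closed[OF X(1) mult] by (simp add: zariski_closure_def)
  obtain F where F: "\<And>f. f \<in> F \<Longrightarrow> real_polynomial_function f"
    and Z_eq: "?Z = {x \<in> carrier G. \<forall>f\<in>F. f (\<rho> x) = 0}"
    using zariski.closed_hull[OF X(1)] unfolding zariski_closed_def zariski_closure_def by blast
  have inv_mult: "inv x \<otimes> z \<in> ?Z" if x: "x \<in> ?Z" and z: "z \<in> ?Z" for x z
  proof -
    have xz: "x \<in> carrier G" "z \<in> carrier G"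
      using x z Z by auto
    have "f (\<rho> (inv x \<otimes> z)) = 0" if f: "f \<in> F" for f
    proof (rule real_polynomial_function_vanishes_backwards[OF F[OF f] invertible_rho[OF xz(1)]])
      show "\<rho> x ** M \<in> \<rho> ` ?Z" if M: "M \<in> \<rho> ` ?Z" for M
      proof -
        obtain y where y: "y \<in> ?Z" "M = \<rho> y"
          using M by blast
        then have "\<rho> x ** M = \<rho> (x \<otimes> y)"
          using rho_mult[OF xz(1)] Z by auto
        then show ?thesis
          using mult_Z[OF x y(1)] by simp
      qed
      show "f M = 0" if "M \<in> \<rho> ` ?Z" for M
        using that f unfolding Z_eq by blast
      have "\<rho> x ** \<rho> (inv x \<otimes> z) = \<rho> z"
        using xz by (simp add: m_assoc[symmetric] flip: rho_mult)
      then show "\<rho> x ** \<rho> (inv x \<otimes> z) \<in> \<rho> ` ?Z"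
        using z by simp
    qed
    then show ?thesis
      using xz unfolding Z_eq by simp
  qed
  obtain x where "x \<in> X"
    using X(2) by blast
  then have x: "x \<in> ?Z"
    by (simp add: zariski_closure_def hull_inc)
  have one: "\<one> \<in> ?Z"
    using inv_mult[OF x x] x Z by (simp add: subset_eq)
  show ?thesis
  proof
    show "inv y \<in> ?Z" if "y \<in> ?Z" for y
      using inv_mult[OF that one] that Z by (simp add: subset_eq)
  qed (use Z mult_Z one in auto)
qed

end


section \<open>Admissible words\<close>

lemma admissible_between_successively:
  "admissible_between K e' e w \<longleftrightarrow>
    w \<noteq> [] \<and> last w = e \<and> successively (\<lambda>a b. trans_prob K a b > 0) (e' # w)"
  by (cases w) (auto simp: admissible_between_def successively_conv_nth nth_Cons successively_Cons split: nat.splits)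

lemma admissible_between_append:
  assumes "admissible_between K e2 e1 v" "admissible_between K e3 e2 u"
  shows "admissible_between K e3 e1 (u @ v)"
  using assms
  by (auto simp: admissible_between_successively successively_append_iff successively_Cons hd_append)

lemma admissible_between_singleton: "admissible_between K e' e [e] \<longleftrightarrow> trans_prob K e' e > 0"
  by (simp add: admissible_between_def)

lemma admissible_pair_iff: "admissible K [e', e] \<longleftrightarrow> trans_prob K e' e > 0"
proof -
  have "\<exists>e''. trans_prob K e'' e' > 0"
    using set_pmf_not_empty[of "K e'"] unfolding trans_prob_def by (metis ex_in_conv pmf_positive)
  then show ?thesis
    by (auto simp: admissible_def admissible_between_successively)
qed

lemma (in group) word_prod_closed: "range g \<subseteq> carrier G \<Longrightarrow> word_prod G g w \<in> carrier G"
  by (induction w) auto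

lemma (in group) word_prod_append:
  assumes "range g \<subseteq> carrier G"
  shows "word_prod G g (u @ v) = word_prod G g u \<otimes> word_prod G g v"
proof (induction u)
  case (Cons a u)
  have "g a \<in> carrier G"
    using assms by auto
  with Cons show ?case
    by (simp add: m_assoc word_prod_closed[OF assms])
qed (simp add: word_prod_closed[OF assms])

definition loop_products :: "('g, 'm) monoid_scheme \<Rightarrow> ('e \<Rightarrow> 'g) \<Rightarrow> ('e \<Rightarrow> 'e pmf) \<Rightarrow> 'e \<Rightarrow> 'g set"
  where "loop_products G g K e = {word_prod G g w |w. admissible_between K e e w}"

lemma loop_cases:
  assumes "admissible_between K e e w"
  obtains (first_return) v where "w = v @ [e]" "e \<notin> set v"
  | (split) u v where "w = u @ v" "admissible_between K e e u" "admissible_between K e e v"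
proof (cases "e \<in> set (butlast w)")
  case False
  moreover have "w = butlast w @ [e]"
    using assms append_butlast_last_id[of w] by (simp add: admissible_between_def)
  ultimately show ?thesis
    using first_return by blast
next
  case True
  then obtain u v where "butlast w = u @ e # v"
    by (meson split_list)
  then have w: "w = (u @ [e]) @ (v @ [e])"
    using assms append_butlast_last_id[of w] by (simp add: admissible_between_def)
  have "admissible_between K e e (u @ [e])" "admissible_between K e e (v @ [e])"
    using assms unfolding w
    by (auto simp: admissible_between_successively successively_append_iff successively_Cons hd_append)
  then show ?thesis
    using split w by blast
qed


section \<open>Paths of the chain\<close>

lemma hitting_time_eqI:
  assumes "n \<ge> 1" "\<omega> n = e" "\<And>m. 1 \<le> m \<Longrightarrow> m < n \<Longrightarrow> \<omega> m \<noteq> e"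
  shows "hitting_time e \<omega> = enat n"
  unfolding hitting_time_def
proof (rule antisym)
  show "(INF n\<in>{n. n \<ge> 1 \<and> \<omega> n = e}. enat n) \<le> enat n"
    using assms(1,2) by (intro INF_lower) simp
  show "enat n \<le> (INF n\<in>{n. n \<ge> 1 \<and> \<omega> n = e}. enat n)"
  proof (rule INF_greatest)
    show "enat n \<le> enat k" if "k \<in> {n. n \<ge> 1 \<and> \<omega> n = e}" for k
      using that assms(3)[of k] by (cases "k < n") auto
  qed
qed

lemma hitting_time_finite_iff: "hitting_time e \<omega> < \<infinity> \<longleftrightarrow> (\<exists>n\<ge>1. \<omega> n = e)"
proof
  assume "\<exists>n\<ge>1. \<omega> n = e"
  then obtain n where "n \<ge> 1" "\<omega> n = e"
    by blast
  then have "hitting_time e \<omega> \<le> enat n"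
    unfolding hitting_time_def by (intro INF_lower) simp
  then show "hitting_time e \<omega> < \<infinity>"
    using enat_ord_code(4) le_less_trans by blast
next
  assume "hitting_time e \<omega> < \<infinity>"
  then have "{n. n \<ge> 1 \<and> \<omega> n = e} \<noteq> {}"
    unfolding hitting_time_def by (metis enat_ord_simps(4) image_empty Inf_empty top_enat_def)
  then show "\<exists>n\<ge>1. \<omega> n = e"
    by blast
qed

lemma hitting_time_eq_iff:
  "hitting_time e \<omega> = enat n \<longleftrightarrow> n \<ge> 1 \<and> \<omega> n = e \<and> (\<forall>m\<in>{1..<n}. \<omega> m \<noteq> e)"
proof
  assume *: "hitting_time e \<omega> = enat n"
  then have ex: "\<exists>m. m \<ge> 1 \<and> \<omega> m = e"
    using hitting_time_finite_iff[of e \<omega>] by auto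
  define m where "m = (LEAST m. m \<ge> 1 \<and> \<omega> m = e)"
  have m: "m \<ge> 1" "\<omega> m = e" "\<And>k. k < m \<Longrightarrow> \<not> (k \<ge> 1 \<and> \<omega> k = e)"
    using LeastI_ex[OF ex] not_less_Least unfolding m_def by blast+
  then have "hitting_time e \<omega> = enat m"
    by (intro hitting_time_eqI) auto
  with * m show "n \<ge> 1 \<and> \<omega> n = e \<and> (\<forall>m\<in>{1..<n}. \<omega> m \<noteq> e)"
    by auto
qed (auto intro: hitting_time_eqI)

lemma measurable_markov_component [measurable]:
  "(\<lambda>\<omega>. \<omega> i) \<in> markov_measure K e \<rightarrow>\<^sub>M count_space UNIV"
  by (subst measurable_cong_sets[OF sets_markov_measure refl]) (rule measurable_component_singleton, simp)

lemma sets_markov_cylinder: "{\<omega>. \<forall>i\<le>n. \<omega> i = w i} \<in> sets (markov_measure K e)"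
proof -
  have "{\<omega> \<in> space (markov_measure K e). \<forall>i\<in>{..n}. \<omega> i = w i} \<in> sets (markov_measure K e)"
    by measurable
  then show ?thesis
    by (simp add: space_markov_measure Ball_def)
qed

lemma AE_markov_path:
  "AE \<omega> in markov_measure K e. \<omega> 0 = e \<and> (\<forall>i. trans_prob K (\<omega> (Suc i)) (\<omega> i) > 0)"
proof -
  let ?M = "markov_measure K e"
  have "AE \<omega> in ?M. \<omega> 0 = e \<and> (\<forall>i<n. trans_prob K (\<omega> (Suc i)) (\<omega> i) > 0)" for n
  proof -
    let ?bad = "{l. length l = Suc n \<and> \<not> (l ! 0 = e \<and> (\<forall>i<n. trans_prob K (l ! Suc i) (l ! i) > 0))}"
    let ?N = "\<Union>l\<in>?bad. {\<omega>. \<forall>i\<le>n. \<omega> i = l ! i}"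
    have null: "{\<omega>. \<forall>i\<le>n. \<omega> i = l ! i} \<in> null_sets ?M" if "l \<in> ?bad" for l
    proof (rule null_setsI[OF _ sets_markov_cylinder])
      have "(\<Prod>i<n. trans_prob K (l ! Suc i) (l ! i)) = 0" if "l ! 0 = e"
      proof -
        obtain i where i: "i < n" "\<not> trans_prob K (l ! Suc i) (l ! i) > 0"
          using \<open>l \<in> ?bad\<close> \<open>l ! 0 = e\<close> by auto
        then have "trans_prob K (l ! Suc i) (l ! i) = 0"
          by (simp add: trans_prob_def pmf_nonneg not_less antisym)
        with i(1) show ?thesis
          by auto
      qed
      then show "emeasure ?M {\<omega>. \<forall>i\<le>n. \<omega> i = l ! i} = 0"
        unfolding emeasure_markov_measure_cylinder
        by (cases "l ! 0 = e") (simp_all only: if_True if_False ennreal_0 simp_thms)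
    qed
    have "?N \<in> null_sets ?M"
      by (rule null_sets_UN'[OF countableI_type null])
    then show ?thesis
    proof (rule AE_I', intro subsetI)
      fix \<omega>
      assume "\<omega> \<in> {\<omega> \<in> space ?M. \<not> (\<omega> 0 = e \<and> (\<forall>i<n. trans_prob K (\<omega> (Suc i)) (\<omega> i) > 0))}"
      then have "\<not> (\<omega> 0 = e \<and> (\<forall>i<n. trans_prob K (\<omega> (Suc i)) (\<omega> i) > 0))"
        by blast
      moreover have nth: "map \<omega> [0..<Suc n] ! i = \<omega> i" if "i \<le> n" for i
        using that nth_map_upt[of i "Suc n" 0 \<omega>] by (simp del: upt_Suc)
      ultimately have "map \<omega> [0..<Suc n] \<in> ?bad"
        by (simp del: upt_Suc cong: conj_cong)
      moreover have "\<omega> \<in> {\<omega>'. \<forall>i\<le>n. \<omega>' i = map \<omega> [0..<Suc n] ! i}"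
        using nth by (simp del: upt_Suc)
      ultimately show "\<omega> \<in> ?N"
        by (rule UN_I)
    qed
  qed
  then have "AE \<omega> in ?M. \<forall>n. \<omega> 0 = e \<and> (\<forall>i<n. trans_prob K (\<omega> (Suc i)) (\<omega> i) > 0)"
    unfolding AE_all_countable by (rule allI)
  then show ?thesis
    by eventually_elim blast
qed

lemma prob_space_markov_measure: "prob_space (markov_measure K e)"
proof
  let ?M = "markov_measure K e"
  have "emeasure ?M {\<omega>. \<forall>i\<le>0. \<omega> i = e} = emeasure ?M (space ?M)"
  proof (rule emeasure_eq_AE[OF _ sets_markov_cylinder sets.top])
    show "AE \<omega> in ?M. (\<omega> \<in> {\<omega>. \<forall>i\<le>0. \<omega> i = e}) = (\<omega> \<in> space ?M)"
      using AE_markov_path[of e K] by eventually_elim (simp add: space_markov_measure)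
  qed
  then show "emeasure ?M (space ?M) = 1"
    using emeasure_markov_measure_cylinder[of K e 0 "\<lambda>_. e"] by simp
qed

lemma path_admissible:
  assumes "n \<ge> 1" "\<And>i. i < n \<Longrightarrow> trans_prob K (\<omega> (Suc i)) (\<omega> i) > 0"
  shows "admissible_between K (\<omega> n) (\<omega> 0) (map \<omega> (rev [0..<n]))"
proof -
  have "successively (\<lambda>a b. trans_prob K a b > 0) (map \<omega> (rev [0..<Suc m]))" if "m \<le> n" for m
    using that
  proof (induction m)
    case (Suc m)
    then show ?case
      using assms(2)[of m] by (simp add: successively_Cons)
  qed simp
  from this[of n] show ?thesis
    using assms(1) by (simp add: admissible_between_successively last_map last_rev hd_map)
qed

lemma irreducible_chain_admissible:
  assumes "irreducible_chain K"
  obtains w where "admissible_between K e' e w"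
proof -
  let ?M = "markov_measure K e"
  have pos: "emeasure ?M {\<omega>. hitting_time e' \<omega> < \<infinity>} > 0"
    using assms by (simp add: irreducible_chain_def)
  have "\<exists>\<omega>. hitting_time e' \<omega> < \<infinity> \<and> \<omega> 0 = e \<and> (\<forall>i. trans_prob K (\<omega> (Suc i)) (\<omega> i) > 0)"
  proof (rule ccontr)
    assume none: "\<not> ?thesis"
    have "AE \<omega> in ?M. \<not> hitting_time e' \<omega> < \<infinity>"
      using AE_markov_path[of e K] by eventually_elim (use none in blast)
    from AE_E2[OF this] pos show False
      by (simp add: space_markov_measure)
  qed
  then obtain \<omega> where \<omega>: "hitting_time e' \<omega> < \<infinity>" "\<omega> 0 = e" "\<And>i. trans_prob K (\<omega> (Suc i)) (\<omega> i) > 0"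
    by blast
  then obtain n where "n \<ge> 1" "\<omega> n = e'"
    using hitting_time_finite_iff by metis
  with path_admissible[of n K \<omega>] \<omega> that show ?thesis
    by blast
qed

lemma AE_recurrent_hitting:
  assumes "recurrent_chain K"
  shows "AE \<omega> in markov_measure K e. hitting_time e \<omega> < \<infinity>"
proof -
  interpret prob_space "markov_measure K e"
    by (rule prob_space_markov_measure)
  have "emeasure (markov_measure K e) {\<omega>. hitting_time e \<omega> < \<infinity>} = 1"
    using assms by (simp add: recurrent_chain_def)
  moreover from this have "{\<omega>. hitting_time e \<omega> < \<infinity>} \<in> events"
    using emeasure_notin_sets by fastforce
  ultimately show ?thesis
    using AE_in_set_eq_1[of "{\<omega>. hitting_time e \<omega> < \<infinity>}"] by (simp add: measure_def)
qed


section \<open>The renewal semigroup\<close>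

locale markov_coding = lie_group G T A
  for G :: "('g, 'm) monoid_scheme" (structure) and T and A :: "('g set \<times> ('g \<Rightarrow> 'v::real_normed_vector)) set" +
  fixes g :: "'e::countable \<Rightarrow> 'g" and K :: "'e \<Rightarrow> 'e pmf"
  assumes coding: "range g \<subseteq> carrier G"
    and irreducible: "irreducible_chain K"
    and recurrent: "recurrent_chain K"
begin

abbreviation (input) "gw \<equiv> word_prod G g"

lemmas gw_closed [simp] = word_prod_closed[OF coding]
  and gw_append = word_prod_append[OF coding]

abbreviation renewal_variable :: "'e \<Rightarrow> (nat \<Rightarrow> 'e) \<Rightarrow> 'g"
  where "renewal_variable e \<omega> \<equiv> (if hitting_time e \<omega> < \<infinity> then gw (renewal_word e \<omega>) else \<one>)"

lemma space_borel_of_topology: "space (borel_of_topology T) = carrier G"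
  unfolding borel_of_topology_def using openin_subset[of T]
  by (subst space_measure_of) (auto simp: topspace_eq)

lemma sets_borel_of_topology: "openin T U \<Longrightarrow> U \<in> sets (borel_of_topology T)"
  unfolding borel_of_topology_def using openin_subset by (subst sets_measure_of) auto

lemma measurable_renewal_variable:
  "renewal_variable e \<in> markov_measure K e' \<rightarrow>\<^sub>M borel_of_topology T"
proof -
  let ?M = "markov_measure K e'"
  define h where "h \<omega> = (if hitting_time e \<omega> < \<infinity> then Some (renewal_word e \<omega>) else None)" for \<omega>
  have fin: "Measurable.pred ?M (\<lambda>\<omega>. hitting_time e \<omega> < \<infinity>)"
    unfolding hitting_time_finite_iff by measurable
  have eq: "Measurable.pred ?M (\<lambda>\<omega>. hitting_time e \<omega> = enat n)" for n
    unfolding hitting_time_eq_iff by measurable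
  have word: "Measurable.pred ?M (\<lambda>\<omega>. \<forall>i\<in>{..<n}. \<omega> i = w ! i)" for w :: "'e list" and n
    by measurable
  have "h -` {y} \<inter> space ?M \<in> sets ?M" for y
  proof (cases y)
    case None
    have "h -` {y} \<inter> space ?M = {\<omega> \<in> space ?M. \<not> hitting_time e \<omega> < \<infinity>}"
      by (auto simp: h_def None split: if_splits)
    also have "\<dots> \<in> sets ?M"
      using fin by measurable
    finally show ?thesis .
  next
    case (Some w)
    have "h \<omega> = y \<longleftrightarrow> hitting_time e \<omega> = enat (length w) \<and> (\<forall>i\<in>{..<length w}. \<omega> i = rev w ! i)" for \<omega>
    proof (cases "hitting_time e \<omega>")
      case (enat n)
      have "map \<omega> (rev [0..<n]) = w \<longleftrightarrow> map \<omega> [0..<n] = rev w"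
        by (metis rev_map rev_rev_ident)
      also have "\<dots> \<longleftrightarrow> n = length w \<and> (\<forall>i\<in>{..<n}. \<omega> i = rev w ! i)"
        by (auto simp: list_eq_iff_nth_eq)
      finally show ?thesis
        using enat by (auto simp: h_def Some renewal_word_def)
    qed (simp add: h_def Some)
    then have "h -` {y} \<inter> space ?M =
        {\<omega> \<in> space ?M. hitting_time e \<omega> = enat (length w) \<and> (\<forall>i\<in>{..<length w}. \<omega> i = rev w ! i)}"
      by auto
    also have "\<dots> \<in> sets ?M"
      using eq word by measurable
    finally show ?thesis .
  qed
  then have "h \<in> ?M \<rightarrow>\<^sub>M count_space UNIV"
    by (simp add: measurable_count_space_eq2_countable)
  moreover have "(\<lambda>y. case y of None \<Rightarrow> \<one> | Some w \<Rightarrow> gw w) \<in> count_space UNIV \<rightarrow>\<^sub>M borel_of_topology T"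
    by (auto simp: space_borel_of_topology split: option.splits)
  ultimately have "(\<lambda>\<omega>. case h \<omega> of None \<Rightarrow> \<one> | Some w \<Rightarrow> gw w) \<in> ?M \<rightarrow>\<^sub>M borel_of_topology T"
    by (rule measurable_compose)
  also have "(\<lambda>\<omega>. case h \<omega> of None \<Rightarrow> \<one> | Some w \<Rightarrow> gw w) = renewal_variable e"
    by (auto simp: h_def)
  finally show ?thesis .
qed

lemma emeasure_renewal_measure:
  "openin T U \<Longrightarrow> emeasure (renewal_measure G T g K e) U =
    emeasure (markov_measure K e) {\<omega>. renewal_variable e \<omega> \<in> U}"
  unfolding renewal_measure_def
  by (subst emeasure_distr[OF measurable_renewal_variable sets_borel_of_topology])
    (auto simp: vimage_def space_markov_measure)

lemma loop_products_subset_carrier: "loop_products G g K e \<subseteq> carrier G"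
  by (auto simp: loop_products_def)

lemma loop_products_mult:
  assumes "x \<in> loop_products G g K e" "y \<in> loop_products G g K e"
  shows "x \<otimes> y \<in> loop_products G g K e"
proof -
  obtain u v where uv: "x = gw u" "y = gw v" "admissible_between K e e u" "admissible_between K e e v"
    using assms by (auto simp: loop_products_def)
  then have "admissible_between K e e (u @ v)"
    by (blast intro: admissible_between_append)
  then show ?thesis
    unfolding loop_products_def uv(1,2) gw_append[symmetric] by blast
qed

lemma loop_products_translate:
  assumes "admissible_between K e' e c" "admissible_between K e e' c'" "x \<in> loop_products G g K e'"
  shows "gw c' \<otimes> x \<otimes> gw c \<in> loop_products G g K e"
proof -
  obtain w where w: "x = gw w" "admissible_between K e' e' w"
    using assms(3) by (auto simp: loop_products_def)
  have "admissible_between K e e ((c' @ w) @ c)"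
    using assms w(2) by (blast intro: admissible_between_append)
  then show ?thesis
    unfolding loop_products_def w(1) gw_append[symmetric] by blast
qed

lemma loop_products_nonempty: "loop_products G g K e \<noteq> {}"
  using irreducible_chain_admissible[OF irreducible, of e e] by (auto simp: loop_products_def)

lemma support_renewal_measure_subset:
  "support T (renewal_measure G T g K e) \<subseteq> closedin T hull loop_products G g K e"
proof
  let ?M = "markov_measure K e" and ?C = "closedin T hull loop_products G g K e"
  interpret top: translation_stable G "closedin T"
    by (rule translation_stable_closedin)
  fix x
  assume x: "x \<in> support T (renewal_measure G T g K e)"
  have op: "openin T (topspace T - ?C)"
    using top.closed_hull[OF loop_products_subset_carrier] by blast
  have "AE \<omega> in ?M. \<not> renewal_variable e \<omega> \<in> topspace T - ?C"
    using AE_markov_path[of e K] AE_recurrent_hitting[OF recurrent, of e]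
  proof eventually_elim
    case (elim \<omega>)
    obtain n where n: "hitting_time e \<omega> = enat n"
      using elim(2) by (cases "hitting_time e \<omega>") auto
    then have "n \<ge> 1" "\<omega> n = e"
      by (auto simp: hitting_time_eq_iff)
    then have "admissible_between K e e (renewal_word e \<omega>)"
      using path_admissible[of n K \<omega>] elim(1) n by (simp add: renewal_word_def)
    then have "gw (renewal_word e \<omega>) \<in> loop_products G g K e"
      by (auto simp: loop_products_def)
    then show ?case
      using n by (simp add: hull_inc)
  qed
  from AE_E2[OF this] have "emeasure ?M {\<omega>. renewal_variable e \<omega> \<in> topspace T - ?C} = 0"
    by (simp only: not_not space_markov_measure UNIV_I simp_thms)
  then have "emeasure (renewal_measure G T g K e) (topspace T - ?C) = 0"
    unfolding emeasure_renewal_measure[OF op] .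
  with x op show "x \<in> ?C"
    unfolding support_def by force
qed

lemma first_return_support:
  assumes adm: "admissible_between K e e w" and w: "w = v @ [e]" "e \<notin> set v"
  shows "gw w \<in> support T (renewal_measure G T g K e)"
proof -
  let ?M = "markov_measure K e" and ?p = "\<lambda>i. rev (e # w) ! i"
  have renewal: "hitting_time e \<omega> = enat (length w)" "renewal_word e \<omega> = w"
    if \<omega>: "\<And>i. i \<le> length w \<Longrightarrow> \<omega> i = ?p i" for \<omega>
  proof -
    show hit: "hitting_time e \<omega> = enat (length w)"
    proof (rule hitting_time_eqI)
      show "\<omega> (length w) = e"
        using \<omega>[of "length w"] by (simp add: nth_append)
      fix m
      assume m: "1 \<le> m" "m < length w"
      then have "m - 1 < length v"
        by (simp add: w)
      then have "\<omega> m = rev v ! (m - 1)"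
        using \<omega>[of m] m by (simp add: w nth_append nth_Cons')
      moreover have "rev v ! (m - 1) \<in> set v"
        using m w(1) nth_mem[of "m - 1" "rev v"] by simp
      ultimately show "\<omega> m \<noteq> e"
        using w(2) by auto
    qed (simp add: w)
    have "map \<omega> [0..<length w] = rev w"
      using \<omega> by (intro nth_equalityI) (simp_all add: nth_append)
    then show "renewal_word e \<omega> = w"
      by (simp add: renewal_word_def hit flip: rev_map)
  qed
  have "successively (\<lambda>a b. trans_prob K b a > 0) (rev (e # w))"
    using adm by (simp only: successively_rev admissible_between_successively)
  then have "trans_prob K (?p (Suc i)) (?p i) > 0" if "i < length w" for i
    using successively_nth[of _ "rev (e # w)" i] that by simp
  then have "(\<Prod>i<length w. trans_prob K (?p (Suc i)) (?p i)) > 0"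
    by (intro prod_pos) simp
  moreover have "?p 0 = e"
    by (simp add: w)
  ultimately have pos: "emeasure ?M {\<omega>. \<forall>i\<le>length w. \<omega> i = ?p i} > 0"
    unfolding emeasure_markov_measure_cylinder by (simp del: rev.simps)
  have "emeasure (renewal_measure G T g K e) U > 0" if U: "openin T U" "gw w \<in> U" for U
  proof -
    have "{\<omega>. renewal_variable e \<omega> \<in> U} \<in> sets ?M"
      using measurable_sets[OF measurable_renewal_variable[of e e] sets_borel_of_topology[OF U(1)]]
      by (simp add: vimage_def space_markov_measure)
    moreover have "{\<omega>. \<forall>i\<le>length w. \<omega> i = ?p i} \<subseteq> {\<omega>. renewal_variable e \<omega> \<in> U}"
      using renewal U(2) by auto
    ultimately show ?thesis
      using pos emeasure_mono[of _ _ ?M] unfolding emeasure_renewal_measure[OF U(1)]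
      by (meson less_le_trans)
  qed
  then show ?thesis
    by (simp add: support_def topspace_eq)
qed

lemma renewal_semigroup_eq: "renewal_semigroup G T g K e = closedin T hull loop_products G g K e"
proof (rule antisym)
  interpret top: translation_stable G "closedin T"
    by (rule translation_stable_closedin)
  let ?L = "loop_products G g K e" and ?supp = "support T (renewal_measure G T g K e)"
  have "closed_subsemigroup G T (closedin T hull ?L)"
    unfolding closed_subsemigroup_def
    using top.closed_hull top.hull_subset_carrier top.hull_mult_closed
      loop_products_subset_carrier[of e] loop_products_mult[of _ e] by simp
  then show "renewal_semigroup G T g K e \<subseteq> closedin T hull ?L"
    unfolding renewal_semigroup_def using support_renewal_measure_subset by (intro hull_minimal)
  have "closedin T hull ?L \<subseteq> S" if S: "closed_subsemigroup G T S" "?supp \<subseteq> S" for S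
  proof (rule hull_minimal)
    have "gw w \<in> S" if "admissible_between K e e w" for w
      using that
    proof (induction "length w" arbitrary: w rule: less_induct)
      case less
      from less.prems show ?case
      proof (cases rule: loop_cases)
        case (first_return v)
        then show ?thesis
          using first_return_support[OF less.prems] S(2) by blast
      next
        case (split u v)
        then have "u \<noteq> []" "v \<noteq> []"
          by (auto simp: admissible_between_def)
        with split less.hyps[of u] less.hyps[of v] have "gw u \<in> S" "gw v \<in> S"
          by auto
        then show ?thesis
          using S(1) by (simp add: split(1) gw_append closed_subsemigroup_def)
      qed
    qed
    then show "?L \<subseteq> S"
      by (auto simp: loop_products_def)
    show "closedin T S"
      using S(1) by (simp add: closed_subsemigroup_def)
  qed
  then show "closedin T hull ?L \<subseteq> renewal_semigroup G T g K e"
    unfolding renewal_semigroup_def hull_def[of "closed_subsemigroup G T"] by blast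
qed

lemma renewal_semigroup_translate:
  assumes c: "admissible_between K e' e c" and c': "admissible_between K e e' c'"
    and x: "x \<in> renewal_semigroup G T g K e'"
  shows "gw c' \<otimes> x \<otimes> gw c \<in> renewal_semigroup G T g K e"
proof -
  interpret top: translation_stable G "closedin T"
    by (rule translation_stable_closedin)
  show ?thesis
    using x unfolding renewal_semigroup_eq
  proof (rule top.hull_translate[rotated -1])
    show "gw c' \<otimes> y \<otimes> gw c \<in> closedin T hull loop_products G g K e"
      if "y \<in> loop_products G g K e'" for y
      using loop_products_translate[OF c c' that] by (rule hull_inc)
  qed (simp_all add: top.closed_hull loop_products_subset_carrier)
qed

end


section \<open>Zariski closures of the renewal semigroups\<close>

lemma (in group) inv_mult_cancel_left:
  assumes "a \<in> carrier G" "x \<in> carrier G"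
  shows "inv a \<otimes> (a \<otimes> x) = x" and "a \<otimes> (inv a \<otimes> x) = x"
  using assms by (simp_all flip: m_assoc)

context subgroup
begin

lemma mult_mem_cancel_right:
  assumes "group G" "a \<in> carrier G" "b \<in> H"
  shows "a \<otimes> b \<in> H \<longleftrightarrow> a \<in> H"
proof -
  interpret group G by fact
  have "a \<otimes> b \<otimes> inv b = a"
    using assms(2,3) by (simp add: m_assoc mem_carrier)
  then show ?thesis
    using assms(3) subgroup.m_closed[OF subgroup_axioms] m_inv_closed by metis
qed

lemma mult_mem_cancel_left:
  assumes "group G" "a \<in> H" "b \<in> carrier G"
  shows "a \<otimes> b \<in> H \<longleftrightarrow> b \<in> H"
proof -
  interpret group G by fact
  have "inv a \<otimes> (a \<otimes> b) = b"
    using assms(2,3) by (simp add: inv_mult_cancel_left mem_carrier)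
  then show ?thesis
    using assms(2) subgroup.m_closed[OF subgroup_axioms] m_inv_closed by metis
qed

lemma conjugate_eq:
  assumes "group G" "h \<in> H"
  shows "h <# H #> inv h = H"
proof -
  interpret group G by fact
  have sub: "subgroup H G"
    by (rule subgroup_axioms)
  then show ?thesis
    using assms(2) by (simp add: coset_join2 coset_join3 mem_carrier m_inv_closed)
qed

end

locale algebraic_markov_coding = markov_coding G T A g K
  for G :: "('g, 'm) monoid_scheme" (structure) and T and A :: "('g set \<times> ('g \<Rightarrow> 'v::real_normed_vector)) set"
    and g :: "'e::countable \<Rightarrow> 'g" and K +
  fixes \<rho> :: "'g \<Rightarrow> real^'d^'d"
  assumes algebraic: "real_algebraic G T \<rho>"
begin

sublocale real_algebraic_group G T \<rho>
  by unfold_locales (fact topspace_eq algebraic)+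

abbreviation "H \<equiv> renewal_zariski G T \<rho> g K"
abbreviation "HS \<equiv> admissible_zariski G \<rho> g K"

lemma renewal_zariski_eq: "H e = zariski_closure G \<rho> (loop_products G g K e)"
proof (rule antisym)
  let ?L = "loop_products G g K e"
  have closed: "zariski_closed G \<rho> (zariski_closure G \<rho> ?L)"
    unfolding zariski_closure_def using loop_products_subset_carrier by (rule zariski.closed_hull)
  have "?L \<subseteq> zariski_closure G \<rho> ?L"
    unfolding zariski_closure_def by (rule hull_subset)
  then have "closedin T hull ?L \<subseteq> zariski_closure G \<rho> ?L"
    using zariski_closed_imp_closedin[OF closed] by (rule hull_minimal)
  then show "H e \<subseteq> zariski_closure G \<rho> ?L"
    unfolding renewal_zariski_def renewal_semigroup_eq using closed
    by (subst zariski_closure_def) (rule hull_minimal)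
  show "zariski_closure G \<rho> ?L \<subseteq> H e"
    unfolding renewal_zariski_def renewal_semigroup_eq zariski_closure_def
    by (intro hull_mono hull_subset)
qed

lemma zariski_closed_H: "zariski_closed G \<rho> (H e)"
  unfolding renewal_zariski_eq zariski_closure_def
  using loop_products_subset_carrier by (rule zariski.closed_hull)

lemma subgroup_H: "subgroup (H e) G"
  unfolding renewal_zariski_eq
  using loop_products_subset_carrier loop_products_nonempty loop_products_mult
  by (rule subgroup_zariski_closure)

lemma H_closed: "x \<in> H e \<Longrightarrow> x \<in> carrier G"
  using subgroup.mem_carrier[OF subgroup_H] .

lemma loop_in_H: "admissible_between K e e w \<Longrightarrow> gw w \<in> H e"
  unfolding renewal_zariski_eq zariski_closure_def loop_products_def by (blast intro: hull_inc)

lemma H_subset_HS: "H e \<subseteq> HS"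
  unfolding renewal_zariski_eq admissible_zariski_def zariski_closure_def
  by (rule hull_mono) (auto simp: loop_products_def admissible_products_def admissible_def)

lemma admissible_in_HS: "admissible_between K e' e w \<Longrightarrow> gw w \<in> HS"
  unfolding admissible_zariski_def zariski_closure_def admissible_products_def admissible_def
  by (blast intro: hull_inc)

lemma H_translate:
  assumes "admissible_between K e' e c" "admissible_between K e e' c'" "x \<in> H e'"
  shows "gw c' \<otimes> x \<otimes> gw c \<in> H e"
proof (rule zariski.hull_translate[OF loop_products_subset_carrier[of e'] zariski_closed_H])
  show "x \<in> zariski_closed G \<rho> hull loop_products G g K e'"
    using assms(3) unfolding renewal_zariski_eq zariski_closure_def .
  show "gw c' \<otimes> y \<otimes> gw c \<in> H e" if "y \<in> loop_products G g K e'" for y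
    unfolding renewal_zariski_eq zariski_closure_def
    using loop_products_translate[OF assms(1,2) that] by (rule hull_inc)
qed simp_all

lemma H_conjugate:
  assumes c: "admissible_between K e' e c" and c': "admissible_between K e e' c'" and x: "x \<in> H e'"
  shows "gw c' \<otimes> x \<otimes> inv (gw c') \<in> H e" and "inv (gw c) \<otimes> x \<otimes> gw c \<in> H e"
proof -
  have [simp]: "x \<in> carrier G"
    using x by (rule H_closed)
  interpret H: subgroup "H e" G
    by (rule subgroup_H)
  have loop: "gw c' \<otimes> gw c \<in> H e"
    using loop_in_H[OF admissible_between_append[OF c c']] by (simp add: gw_append)
  have "gw c' \<otimes> x \<otimes> inv (gw c') \<otimes> (gw c' \<otimes> gw c) = gw c' \<otimes> x \<otimes> gw c"
    by (simp add: m_assoc inv_mult_cancel_left)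
  then show "gw c' \<otimes> x \<otimes> inv (gw c') \<in> H e"
    using H_translate[OF c c' x] H.mult_mem_cancel_right[OF is_group _ loop, of "gw c' \<otimes> x \<otimes> inv (gw c')"]
    by simp
  have "gw c' \<otimes> gw c \<otimes> (inv (gw c) \<otimes> x \<otimes> gw c) = gw c' \<otimes> x \<otimes> gw c"
    by (simp add: m_assoc inv_mult_cancel_left)
  then show "inv (gw c) \<otimes> x \<otimes> gw c \<in> H e"
    using H_translate[OF c c' x] H.mult_mem_cancel_left[OF is_group loop, of "inv (gw c) \<otimes> x \<otimes> gw c"]
    by simp
qed

lemma conjugate_set: "a <# B #> b = (\<lambda>x. a \<otimes> x \<otimes> b) ` B"
  by (auto simp: l_coset_def r_coset_def)

lemma H_conjugate_eq:
  assumes c: "admissible_between K e' e c" and c': "admissible_between K e e' c'"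
  shows "gw c' <# H e' #> inv (gw c') = H e" and "inv (gw c) <# H e' #> gw c = H e"
proof -
  have "x \<in> gw c' <# H e' #> inv (gw c')" if x: "x \<in> H e" for x
  proof -
    have "x = gw c' \<otimes> (inv (gw c') \<otimes> x \<otimes> gw c') \<otimes> inv (gw c')"
      using H_closed[OF x] by (simp add: m_assoc inv_mult_cancel_left)
    then show ?thesis
      unfolding conjugate_set using H_conjugate(2)[OF c' c x] by blast
  qed
  then show "gw c' <# H e' #> inv (gw c') = H e"
    using H_conjugate(1)[OF c c'] by (auto simp: conjugate_set)
  have "x \<in> inv (gw c) <# H e' #> gw c" if x: "x \<in> H e" for x
  proof -
    have "x = inv (gw c) \<otimes> (gw c \<otimes> x \<otimes> inv (gw c)) \<otimes> gw c"
      using H_closed[OF x] by (simp add: m_assoc inv_mult_cancel_left)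
    then show ?thesis
      unfolding conjugate_set using H_conjugate(1)[OF c' c x] by blast
  qed
  then show "inv (gw c) <# H e' #> gw c = H e"
    using H_conjugate(2)[OF c c'] by (auto simp: conjugate_set)
qed

lemma H_eq_if_connecting_word_in_H:
  assumes "admissible_between K e e' w" "gw w \<in> H e'"
  shows "H e = H e'"
proof -
  obtain c where "admissible_between K e' e c"
    using irreducible_chain_admissible[OF irreducible] by blast
  from H_conjugate_eq(1)[OF this assms(1)] show ?thesis
    using subgroup.conjugate_eq[OF subgroup_H is_group assms(2)] by simp
qed

lemma H_eq_common_predecessor:
  assumes "trans_prob K e d > 0" "trans_prob K e' d > 0"
  shows "H e = H e'"
proof -
  obtain u where u: "admissible_between K d e' u"
    using irreducible_chain_admissible[OF irreducible] by blast
  have "admissible_between K f e' ([d] @ u)" if "trans_prob K f d > 0" for f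
    using that by (intro admissible_between_append[OF u]) (simp add: admissible_between_singleton)
  with assms loop_in_H show ?thesis
    by (intro H_eq_if_connecting_word_in_H) blast+
qed

lemma H_eq_HS_if_admissible_in_H:
  assumes "\<And>e e' w. admissible_between K e' e w \<Longrightarrow> gw w \<in> H d"
  shows "H f = HS"
proof -
  have "HS \<subseteq> H d"
    unfolding admissible_zariski_def zariski_closure_def using zariski_closed_H assms
    by (intro hull_minimal) (auto simp: admissible_products_def admissible_def)
  moreover obtain w where "admissible_between K f d w"
    using irreducible_chain_admissible[OF irreducible] by blast
  ultimately show ?thesis
    using H_eq_if_connecting_word_in_H assms H_subset_HS by blast
qed

lemma H_eq_HS_universal_predecessor:
  assumes d: "\<And>f. trans_prob K f d > 0"
  shows "H f = HS"
proof (rule H_eq_HS_if_admissible_in_H)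
  fix e e' w
  assume w: "admissible_between K e' e w"
  interpret H: subgroup "H d" G
    by (rule subgroup_H)
  have single: "admissible_between K f d [d]" for f
    using d by (simp add: admissible_between_singleton)
  obtain u where u: "admissible_between K d e' u"
    using irreducible_chain_admissible[OF irreducible] by blast
  have gd: "gw [d] \<in> H d"
    by (rule loop_in_H[OF single])
  have "gw u \<otimes> gw [d] \<in> H d"
    using loop_in_H[OF admissible_between_append[OF single u]] unfolding gw_append .
  then have gu: "gw u \<in> H d"
    using H.mult_mem_cancel_right[OF is_group gw_closed gd] by blast
  have "gw u \<otimes> (gw w \<otimes> gw [d]) \<in> H d"
    using loop_in_H[OF admissible_between_append[OF admissible_between_append[OF single w] u]]
    unfolding gw_append .
  then show "gw w \<in> H d"
    using H.mult_mem_cancel_left[OF is_group gu, of "gw w \<otimes> gw [d]"]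
      H.mult_mem_cancel_right[OF is_group gw_closed gd, of w] m_closed[OF gw_closed gw_closed] by blast
qed

lemma H_eq_HS_universal_successor:
  assumes d: "\<And>f. trans_prob K d f > 0"
  shows "H f = HS"
proof (rule H_eq_HS_if_admissible_in_H)
  fix e e' w
  assume w: "admissible_between K e' e w"
  interpret H: subgroup "H d" G
    by (rule subgroup_H)
  have to_d: "admissible_between K d e v" if "admissible_between K e' e v" for e e' v
    using that d by (simp add: admissible_between_def)
  obtain u where u: "admissible_between K e d u"
    using irreducible_chain_admissible[OF irreducible] by blast
  have "gw w \<otimes> gw u \<in> H d"
    using loop_in_H[OF admissible_between_append[OF u to_d[OF w]]] unfolding gw_append .
  then show "gw w \<in> H d"
    using H.mult_mem_cancel_right[OF is_group gw_closed loop_in_H[OF to_d[OF u]]] by blast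
qed

lemma H_subset_normalizer: "H e \<subseteq> normalizer G (H e)"
  using subgroup.conjugate_eq[OF subgroup_H is_group] subgroup.subset[OF subgroup_H] H_closed
  unfolding normalizer_def stabilizer_def by auto

end

theorem lemma3p6:
  fixes G :: "('g, 'm) monoid_scheme"
    and T :: "'g topology"
    and A :: "('g set \<times> ('g \<Rightarrow> 'v::real_normed_vector)) set"
    and \<rho> :: "'g \<Rightarrow> real^'d^'d"
    and g :: "'e::countable \<Rightarrow> 'g"
    and K :: "'e \<Rightarrow> 'e pmf"
    and e e' :: 'e
  defines "Gp \<equiv> renewal_semigroup G T g K"
    and "H \<equiv> renewal_zariski G T \<rho> g K"
    and "HS \<equiv> admissible_zariski G \<rho> g K"
    and "gw \<equiv> word_prod G g"
  assumes "lie_group G T A"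
    and "range g \<subseteq> carrier G"
    and "irreducible_chain K"
    and "recurrent_chain K"
  shows
    "(\<forall>c c'. admissible_between K e' e c \<and> admissible_between K e e' c' \<longrightarrow>
        gw c' <#\<^bsub>G\<^esub> Gp e' #>\<^bsub>G\<^esub> gw c \<subseteq> Gp e) \<and>
     (real_algebraic G T \<rho> \<longrightarrow>
        (subgroup (H e) G \<and> subgroup (H e') G \<and> H e \<subseteq> HS \<and> H e' \<subseteq> HS \<and>
         (\<exists>h\<in>HS. h <#\<^bsub>G\<^esub> H e' #>\<^bsub>G\<^esub> inv\<^bsub>G\<^esub> h = H e) \<and>
         (\<forall>c c'. admissible_between K e' e c \<and> admissible_between K e e' c' \<longrightarrow>
            gw c' <#\<^bsub>G\<^esub> H e' #>\<^bsub>G\<^esub> inv\<^bsub>G\<^esub> gw c' = H e \<and>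
            inv\<^bsub>G\<^esub> gw c <#\<^bsub>G\<^esub> H e' #>\<^bsub>G\<^esub> gw c = H e)) \<and>
        ((\<exists>d. admissible K [e, d] \<and> admissible K [e', d]) \<longrightarrow> H e = H e') \<and>
        ((\<exists>d. \<forall>f. admissible K [f, d]) \<longrightarrow>
          (\<forall>f f'. H f = H f') \<and> (\<forall>f. HS \<subseteq> normalizer G (H f))) \<and>
        ((\<exists>d. \<forall>f. admissible K [d, f]) \<longrightarrow>
          (\<forall>f. H f = HS) \<and> subgroup HS G))"
proof (intro conjI impI)
  interpret markov_coding G T A g K
    using assms(5-8) by (simp add: markov_coding_def markov_coding_axioms_def)
  show "\<forall>c c'. admissible_between K e' e c \<and> admissible_between K e e' c' \<longrightarrow>
      gw c' <#\<^bsub>G\<^esub> Gp e' #>\<^bsub>G\<^esub> gw c \<subseteq> Gp e"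
    unfolding Gp_def gw_def using renewal_semigroup_translate by (auto simp: l_coset_def r_coset_def)
  assume "real_algebraic G T \<rho>"
  then interpret algebraic_markov_coding G T A g K \<rho>
    by unfold_locales
  show "subgroup (H e) G" "subgroup (H e') G" "H e \<subseteq> HS" "H e' \<subseteq> HS"
    unfolding H_def HS_def by (fact subgroup_H H_subset_HS)+
  have conj: "gw c' <#\<^bsub>G\<^esub> H e' #>\<^bsub>G\<^esub> inv\<^bsub>G\<^esub> gw c' = H e"
    "inv\<^bsub>G\<^esub> gw c <#\<^bsub>G\<^esub> H e' #>\<^bsub>G\<^esub> gw c = H e"
    if "admissible_between K e' e c" "admissible_between K e e' c'" for c c'
    unfolding H_def gw_def using H_conjugate_eq[OF that] .
  then show "\<forall>c c'. admissible_between K e' e c \<and> admissible_between K e e' c' \<longrightarrow>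
      gw c' <#\<^bsub>G\<^esub> H e' #>\<^bsub>G\<^esub> inv\<^bsub>G\<^esub> gw c' = H e \<and>
      inv\<^bsub>G\<^esub> gw c <#\<^bsub>G\<^esub> H e' #>\<^bsub>G\<^esub> gw c = H e"
    by blast
  obtain c c' where "admissible_between K e' e c" "admissible_between K e e' c'"
    using irreducible_chain_admissible[OF assms(7)] by metis
  then show "\<exists>h\<in>HS. h <#\<^bsub>G\<^esub> H e' #>\<^bsub>G\<^esub> inv\<^bsub>G\<^esub> h = H e"
    using conj(1) admissible_in_HS unfolding HS_def gw_def by blast
  show "H e = H e'" if "\<exists>d. admissible K [e, d] \<and> admissible K [e', d]"
    unfolding H_def using that H_eq_common_predecessor by (auto simp: admissible_pair_iff)
  have pred: "H f = HS" if "\<exists>d. \<forall>f. admissible K [f, d]" for f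
    unfolding H_def HS_def using that H_eq_HS_universal_predecessor by (auto simp: admissible_pair_iff)
  then show "\<forall>f f'. H f = H f'" if "\<exists>d. \<forall>f. admissible K [f, d]"
    using that by metis
  show "\<forall>f. HS \<subseteq> normalizer G (H f)" if "\<exists>d. \<forall>f. admissible K [f, d]"
    using pred[OF that] H_subset_normalizer unfolding H_def by metis
  have succ: "H f = HS" if "\<exists>d. \<forall>f. admissible K [d, f]" for f
    unfolding H_def HS_def using that H_eq_HS_universal_successor by (auto simp: admissible_pair_iff)
  then show "\<forall>f. H f = HS" if "\<exists>d. \<forall>f. admissible K [d, f]"
    using that by blast
  show "subgroup HS G" if "\<exists>d. \<forall>f. admissible K [d, f]"
    using succ[OF that, of e] subgroup_H[of e] unfolding H_def by simp
qed

end
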